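(* Let $G=(V,E)$ be a finite, strongly connected directed multigraph with $n=\#V$ and let $s\in V$. Then \[\mathrm{Rec}(G,s)/\langle\gamma_s\rangle\;\cong\;K(G,s)/\langle\overline{\beta_s}\rangle\;\cong\;\mathbb{Z}^n_0/\Delta\mathbb{Z}^n.\]
   Context: Identify $V$ with $\{1,\dots,n\}$. $d_{vw}$ is the number of directed edges from $v$ to $w$, $d_v$ the outdegree of $v$. The (total) Laplacian is the $n\times n$ matrix with $\Delta_{vw}=-d_{wv}$ for $v\ne w$ and $\Delta_{vv}=d_v-d_{vv}$; $\Delta\mathbb{Z}^n$ is its integer column span, and $\mathbb{Z}^n_0$ is the set of integer vectors with coordinate sum $0$. $\Delta_s$ is $\Delta$ with the row and column of $s$ deleted; $K(G,s)=\mathbb{Z}^{n-1}/\Delta_s\mathbb{Z}^{n-1}$ (coordinates indexed by $V\setminus\{s\}$). $\beta_s\in\mathbb{Z}^{n-1}$ is $\beta_s(v)=d_{sv}$ and $\overline{\beta_s}$ its class in $K(G,s)$. A sandpile is $\eta\in\mathbb{Z}^{n-1}$ (indexed by nonsink vertices); it is stable if $\eta(v)<d_v$ for all $v\neq s$; a nonsink vertex $v$ with $\eta(v)\ge d_v$ may fire, replacing $\eta$ by $\eta-\Delta_s\delta_v$. Every sandpile reaches a stable sandpile by such firings, which is independent of the order; call it the stabilization $\eta^\circ$. A sandpile $\eta$ is accessible if from any sandpile one can obtain $\eta$ by adding a nonnegative number of grains at each nonsink vertex and then firing active nonsink vertices; recurrent means stable and accessible. $\mathrm{Rec}(G,s)$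 is the set of recurrent sandpiles, a group under $\eta\oplus\xi=(\eta+\xi)^\circ$, isomorphic to $K(G,s)$ via inclusion. $e_s$ denotes its identity (the unique recurrent sandpile in $\Delta_s\mathbb{Z}^{n-1}$), and $\gamma_s=(e_s+\beta_s)^\circ$. *)

theory Defs
  imports "Graph_Theory.Graph_Theory" "HOL-Algebra.Algebra"
begin

section \<open>Integer vectors and matrices indexed by a finite set\<close>

text \<open>The vertex set itself serves as index set. A vector is an extensional function on \<open>I\<close>
  (value \<open>undefined\<close> outside \<open>I\<close>); a matrix is a binary function of which only the entries
  in \<open>I \<times> I\<close> matter.\<close>

definition int_vecs :: "'a set \<Rightarrow> ('a \<Rightarrow> int) monoid" where
  "int_vecs I = product_group I (\<lambda>_. integer_group)"

definition mat_vec :: "'a set \<Rightarrow> ('a \<Rightarrow> 'a \<Rightarrow> int) \<Rightarrow> ('a \<Rightarrow> int) \<Rightarrow> ('a \<Rightarrow> int)" where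
  "mat_vec I A x = (\<lambda>v\<in>I. \<Sum>w\<in>I. A v w * x w)"

definition column_span :: "'a set \<Rightarrow> ('a \<Rightarrow> 'a \<Rightarrow> int) \<Rightarrow> ('a \<Rightarrow> int) set" where
  "column_span I A = mat_vec I A ` carrier (int_vecs I)"

definition unit_vec_on :: "'a set \<Rightarrow> 'a \<Rightarrow> ('a \<Rightarrow> int)" where
  "unit_vec_on I v = (\<lambda>w\<in>I. if w = v then 1 else 0)"

definition zero_sum_vecs :: "'a set \<Rightarrow> ('a \<Rightarrow> int) monoid" where
  "zero_sum_vecs I =
     (int_vecs I)\<lparr>carrier := {x \<in> carrier (int_vecs I). (\<Sum>v\<in>I. x v) = 0}\<rparr>"


section \<open>Laplacian and critical group of a directed multigraph\<close>

text \<open>Loops and parallel arcs are allowed; a loop counts towards the outdegree.\<close>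

definition arc_mult :: "('a, 'b) pre_digraph \<Rightarrow> 'a \<Rightarrow> 'a \<Rightarrow> nat" where
  "arc_mult G v w = card {e \<in> arcs G. tail G e = v \<and> head G e = w}"

definition laplacian :: "('a, 'b) pre_digraph \<Rightarrow> 'a \<Rightarrow> 'a \<Rightarrow> int" where
  "laplacian G v w =
     (if v = w then int (out_degree G v) - int (arc_mult G v v) else - int (arc_mult G w v))"

abbreviation nonsink :: "('a, 'b) pre_digraph \<Rightarrow> 'a \<Rightarrow> 'a set" where
  "nonsink G s \<equiv> verts G - {s}"

text \<open>The reduced Laplacian is the same matrix with the index set cut down to the nonsink
  vertices.\<close>

abbreviation reduced_lattice :: "('a, 'b) pre_digraph \<Rightarrow> 'a \<Rightarrow> ('a \<Rightarrow> int) set" where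
  "reduced_lattice G s \<equiv> column_span (nonsink G s) (laplacian G)"

definition critical_group :: "('a, 'b) pre_digraph \<Rightarrow> 'a \<Rightarrow> ('a \<Rightarrow> int) set monoid" where
  "critical_group G s = int_vecs (nonsink G s) Mod reduced_lattice G s"

definition beta :: "('a, 'b) pre_digraph \<Rightarrow> 'a \<Rightarrow> ('a \<Rightarrow> int)" where
  "beta G s = (\<lambda>v\<in>nonsink G s. int (arc_mult G s v))"

definition beta_class :: "('a, 'b) pre_digraph \<Rightarrow> 'a \<Rightarrow> ('a \<Rightarrow> int) set" where
  "beta_class G s = reduced_lattice G s #>\<^bsub>int_vecs (nonsink G s)\<^esub> beta G s"


section \<open>Sandpiles\<close>

text \<open>Entries of a sandpile may be negative.\<close>

abbreviation sandpiles :: "('a, 'b) pre_digraph \<Rightarrow> 'a \<Rightarrow> ('a \<Rightarrow> int) set" where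
  "sandpiles G s \<equiv> carrier (int_vecs (nonsink G s))"

definition stable :: "('a, 'b) pre_digraph \<Rightarrow> 'a \<Rightarrow> ('a \<Rightarrow> int) \<Rightarrow> bool" where
  "stable G s \<eta> \<longleftrightarrow> (\<forall>v\<in>nonsink G s. \<eta> v < int (out_degree G v))"

definition fire :: "('a, 'b) pre_digraph \<Rightarrow> 'a \<Rightarrow> 'a \<Rightarrow> ('a \<Rightarrow> int) \<Rightarrow> ('a \<Rightarrow> int)" where
  "fire G s v \<eta> = (\<lambda>w\<in>nonsink G s.
     \<eta> w - mat_vec (nonsink G s) (laplacian G) (unit_vec_on (nonsink G s) v) w)"

definition legal_fire :: "('a, 'b) pre_digraph \<Rightarrow> 'a \<Rightarrow> ('a \<Rightarrow> int) \<Rightarrow> ('a \<Rightarrow> int) \<Rightarrow> bool" where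
  "legal_fire G s \<eta> \<xi> \<longleftrightarrow>
     (\<exists>v\<in>nonsink G s. int (out_degree G v) \<le> \<eta> v \<and> \<xi> = fire G s v \<eta>)"

definition stabilization :: "('a, 'b) pre_digraph \<Rightarrow> 'a \<Rightarrow> ('a \<Rightarrow> int) \<Rightarrow> ('a \<Rightarrow> int)" where
  "stabilization G s \<eta> = (THE \<xi>. (legal_fire G s)\<^sup>*\<^sup>* \<eta> \<xi> \<and> stable G s \<xi>)"

definition accessible :: "('a, 'b) pre_digraph \<Rightarrow> 'a \<Rightarrow> ('a \<Rightarrow> int) \<Rightarrow> bool" where
  "accessible G s \<eta> \<longleftrightarrow>
     (\<forall>\<sigma>\<in>sandpiles G s. \<exists>\<alpha>\<in>sandpiles G s. (\<forall>v\<in>nonsink G s. 0 \<le> \<alpha> v) \<and>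
        (legal_fire G s)\<^sup>*\<^sup>* (\<sigma> \<otimes>\<^bsub>int_vecs (nonsink G s)\<^esub> \<alpha>) \<eta>)"

definition recurrents :: "('a, 'b) pre_digraph \<Rightarrow> 'a \<Rightarrow> ('a \<Rightarrow> int) set" where
  "recurrents G s = {\<eta> \<in> sandpiles G s. stable G s \<eta> \<and> accessible G s \<eta>}"

definition sandpile_add ::
    "('a, 'b) pre_digraph \<Rightarrow> 'a \<Rightarrow> ('a \<Rightarrow> int) \<Rightarrow> ('a \<Rightarrow> int) \<Rightarrow> ('a \<Rightarrow> int)" where
  "sandpile_add G s \<eta> \<xi> = stabilization G s (\<eta> \<otimes>\<^bsub>int_vecs (nonsink G s)\<^esub> \<xi>)"

definition sandpile_identity :: "('a, 'b) pre_digraph \<Rightarrow> 'a \<Rightarrow> ('a \<Rightarrow> int)" where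
  "sandpile_identity G s = (THE e. e \<in> recurrents G s \<and>
     (\<forall>\<eta>\<in>recurrents G s. sandpile_add G s e \<eta> = \<eta> \<and> sandpile_add G s \<eta> e = \<eta>))"

definition sandpile_group :: "('a, 'b) pre_digraph \<Rightarrow> 'a \<Rightarrow> ('a \<Rightarrow> int) monoid" where
  "sandpile_group G s = \<lparr>carrier = recurrents G s, monoid.mult = sandpile_add G s,
     one = sandpile_identity G s\<rparr>"

definition gamma :: "('a, 'b) pre_digraph \<Rightarrow> 'a \<Rightarrow> ('a \<Rightarrow> int)" where
  "gamma G s =
     stabilization G s (sandpile_identity G s \<otimes>\<^bsub>int_vecs (nonsink G s)\<^esub> beta G s)"

end

theory Submission
  imports Defs "HOL-Library.Confluence"
begin

text \<open>Every class of integer vectors modulo the reduced lattice contains exactly one recurrent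
  sandpile. Adding to a class representative a large lattice vector and stabilizing yields a
  recurrent. For uniqueness, some lattice vector \<open>\<epsilon> \<ge> 1\<close> satisfies \<open>(\<eta> + k \<epsilon>)\<degree> = \<eta>\<close> for all
  recurrent \<open>\<eta>\<close>; if \<open>\<eta> - \<xi> = \<Delta>\<^sub>s z\<close> with both recurrent, then for large \<open>k\<close> firing the
  positive part of \<open>z\<close> from \<open>\<eta> + k \<epsilon>\<close> and the negative part from \<open>\<xi> + k \<epsilon>\<close> is legal and leads
  to the same sandpile. Hence the sandpile group is isomorphic to the critical group, with
  \<open>\<gamma>\<^sub>s\<close> corresponding to the class of \<open>\<beta>\<^sub>s\<close>. Dropping the sink coordinate maps the zero-sum
  vectors onto the reduced ones, and sends \<open>\<Delta> \<int>\<^sup>n\<close> onto the reduced lattice extended by \<open>\<beta>\<^sub>s\<close>.\<close>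

section \<open>Integer vectors\<close>

lemma carrier_int_vecs: "carrier (int_vecs I) = extensional I"
  by (auto simp: int_vecs_def PiE_def)

lemma mult_int_vecs: "x \<otimes>\<^bsub>int_vecs I\<^esub> y = (\<lambda>v\<in>I. x v + y v)"
  by (simp add: int_vecs_def)

lemma one_int_vecs: "\<one>\<^bsub>int_vecs I\<^esub> = (\<lambda>v\<in>I. 0)"
  by (simp add: int_vecs_def)

lemma comm_group_int_vecs: "comm_group (int_vecs I)"
proof (rule group.group_comm_groupI)
  show "group (int_vecs I)"
    unfolding int_vecs_def by (rule product_group) simp
qed (auto simp: mult_int_vecs add.commute)

lemma group_int_vecs: "group (int_vecs I)"
  using comm_group_int_vecs comm_group.axioms(2) by blast

lemma inv_int_vecs:
  assumes "x \<in> extensional I"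
  shows "inv\<^bsub>int_vecs I\<^esub> x = (\<lambda>v\<in>I. - x v)"
  by (rule group.inv_equality[OF group_int_vecs])
    (use assms in \<open>auto simp: mult_int_vecs one_int_vecs carrier_int_vecs\<close>)

lemma int_pow_int_vecs:
  assumes "x \<in> extensional I"
  shows "x [^]\<^bsub>int_vecs I\<^esub> (k::int) = (\<lambda>v\<in>I. k * x v)"
proof -
  have nat: "x [^]\<^bsub>int_vecs I\<^esub> (n::nat) = (\<lambda>v\<in>I. int n * x v)" for n
  proof (induction n)
    case 0
    then show ?case
      using group.is_monoid[OF group_int_vecs] by (simp add: monoid.nat_pow_0 one_int_vecs)
  next
    case (Suc n)
    then show ?case
      using group.is_monoid[OF group_int_vecs]
      by (auto simp: monoid.nat_pow_Suc mult_int_vecs algebra_simps)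
  qed
  show ?thesis
    by (auto simp: int_pow_def2 nat inv_int_vecs)
qed

lemma hom_mat_vec: "mat_vec I A \<in> hom (int_vecs I) (int_vecs I)"
  by (auto simp: hom_def carrier_int_vecs mult_int_vecs mat_vec_def sum.distrib distrib_left
      intro!: restrict_ext)

lemma subgroup_column_span: "subgroup (column_span I A) (int_vecs I)"
  unfolding column_span_def
  by (rule group_hom.img_is_subgroup)
    (simp add: group_hom_def group_hom_axioms_def group_int_vecs hom_mat_vec)

text \<open>The coefficients \<open>y\<close> may be arbitrary functions, since values off
  \<open>I\<close> never enter the sum. Later witnesses thus need not be extensional.\<close>

lemma column_span_iff:
  "x \<in> column_span I A \<longleftrightarrow> x \<in> extensional I \<and> (\<exists>y. \<forall>v\<in>I. x v = (\<Sum>w\<in>I. A v w * y w))"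
proof
  assume "x \<in> column_span I A"
  then show "x \<in> extensional I \<and> (\<exists>y. \<forall>v\<in>I. x v = (\<Sum>w\<in>I. A v w * y w))"
    by (auto simp: column_span_def mat_vec_def)
next
  assume "x \<in> extensional I \<and> (\<exists>y. \<forall>v\<in>I. x v = (\<Sum>w\<in>I. A v w * y w))"
  then obtain y where "x \<in> extensional I" and y: "\<forall>v\<in>I. x v = (\<Sum>w\<in>I. A v w * y w)"
    by blast
  then have "x = mat_vec I A (restrict y I)"
    by (auto simp: mat_vec_def extensional_def fun_eq_iff)
  then show "x \<in> column_span I A"
    by (auto simp: column_span_def carrier_int_vecs)
qed

lemma (in group) r_coset_eq_iff:
  assumes "subgroup H G" "x \<in> carrier G" "y \<in> carrier G"
  shows "H #> x = H #> y \<longleftrightarrow> x \<otimes> inv y \<in> H"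
  using subgroup.rcos_module[OF assms(1) group_axioms assms(3,2)] assms
  by (metis repr_independence repr_independenceD)

lemma column_span_coset_eq_iff:
  assumes "x \<in> extensional I" "y \<in> extensional I"
  shows "column_span I A #>\<^bsub>int_vecs I\<^esub> x = column_span I A #>\<^bsub>int_vecs I\<^esub> y
    \<longleftrightarrow> (\<exists>z. \<forall>v\<in>I. x v = y v + (\<Sum>w\<in>I. A v w * z w))"
  using assms
  by (subst group.r_coset_eq_iff[OF group_int_vecs subgroup_column_span])
    (auto simp: carrier_int_vecs inv_int_vecs mult_int_vecs column_span_iff algebra_simps)

lemma subgroup_zero_sum_vecs: "subgroup (carrier (zero_sum_vecs I)) (int_vecs I)"
proof (rule group.subgroupI[OF group_int_vecs])
  show "carrier (zero_sum_vecs I) \<subseteq> carrier (int_vecs I)"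
    by (auto simp: zero_sum_vecs_def)
  have "(\<lambda>v\<in>I. 0) \<in> carrier (zero_sum_vecs I)"
    by (simp add: zero_sum_vecs_def carrier_int_vecs)
  then show "carrier (zero_sum_vecs I) \<noteq> {}"
    by blast
qed (auto simp: zero_sum_vecs_def carrier_int_vecs inv_int_vecs mult_int_vecs sum.distrib sum_negf)

lemma group_zero_sum_vecs: "group (zero_sum_vecs I)"
  using subgroup.subgroup_is_group[OF subgroup_zero_sum_vecs group_int_vecs]
  by (simp add: zero_sum_vecs_def)

text \<open>The first isomorphism theorem with the kernel given by a membership criterion; both
  isomorphisms of the theorem are obtained from it.\<close>

lemma (in group_hom) Mod_iso:
  assumes "h ` carrier G = carrier H" "\<And>x. x \<in> carrier G \<Longrightarrow> h x = \<one>\<^bsub>H\<^esub> \<longleftrightarrow> x \<in> N" "N \<subseteq> carrier G"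
  shows "G Mod N \<cong> H"
proof -
  have "kernel G H h = N"
    using assms(2,3) by (auto simp: kernel_def)
  then show ?thesis
    using FactGroup_iso[OF assms(1)] by simp
qed

lemma sum_mult_unit:
  fixes f :: "'a \<Rightarrow> int"
  assumes "finite A" "v \<in> A"
  shows "(\<Sum>w\<in>A. f w * (if w = v then 1 else 0)) = f v"
proof -
  have "(\<Sum>w\<in>A. f w * (if w = v then 1 else 0)) = (\<Sum>w\<in>A. if w = v then f w else 0)"
    by (rule sum.cong) auto
  with assms show ?thesis by simp
qed

section \<open>The Laplacian and a firing potential\<close>

text \<open>Loops need no separate case: a loop is counted in the outdegree and returned by the
  subtracted multiplicity.\<close>

lemma laplacian_alt:
  "laplacian G v w = (if v = w then int (out_degree G w) else 0) - int (arc_mult G w v)"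
  by (simp add: laplacian_def)

lemma (in fin_digraph) sum_arc_mult:
  "(\<Sum>w\<in>verts G. int (arc_mult G v w)) = int (out_degree G v)"
proof -
  have "(\<Sum>w\<in>verts G. sum (\<lambda>_. 1::nat) {e \<in> out_arcs G v. head G e = w}) = sum (\<lambda>_. 1) (out_arcs G v)"
    by (rule sum.group) auto
  moreover have "{e \<in> out_arcs G v. head G e = w} = {e \<in> arcs G. tail G e = v \<and> head G e = w}" for w
    by auto
  ultimately show ?thesis
    by (simp add: out_degree_def arc_mult_def flip: of_nat_sum)
qed

text \<open>Conservation of grains: over all vertices, sink included, what \<open>w\<close> loses by
  firing arrives at the heads of its arcs.\<close>

lemma (in fin_digraph) sum_laplacian_col:
  assumes "w \<in> verts G"
  shows "(\<Sum>v\<in>verts G. laplacian G v w) = 0"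
  using assms by (simp add: laplacian_alt sum_subtractf sum_arc_mult)

lemma (in fin_digraph) sum_mat_vec_laplacian:
  "(\<Sum>v\<in>verts G. \<Sum>w\<in>verts G. laplacian G v w * y w) = 0"
proof -
  have "(\<Sum>v\<in>verts G. \<Sum>w\<in>verts G. laplacian G v w * y w)
      = (\<Sum>w\<in>verts G. (\<Sum>v\<in>verts G. laplacian G v w) * y w)"
    unfolding sum_distrib_right by (rule sum.swap)
  then show ?thesis
    by (simp add: sum_laplacian_col)
qed

lemma (in fin_digraph) column_span_laplacian_subset:
  "column_span (verts G) (laplacian G) \<subseteq> carrier (zero_sum_vecs (verts G))"
  using sum_mat_vec_laplacian by (auto simp: column_span_iff zero_sum_vecs_def carrier_int_vecs)

locale sandpile_digraph = fin_digraph G for G :: "('a, 'b) pre_digraph" +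
  fixes s :: 'a
  assumes strong: "strongly_connected G" and sink: "s \<in> verts G"
begin

abbreviation "odeg v \<equiv> int (out_degree G v)"
abbreviation "Z \<equiv> int_vecs (nonsink G s)"
abbreviation "legal \<equiv> legal_fire G s"
abbreviation "cls x \<equiv> reduced_lattice G s #>\<^bsub>Z\<^esub> x"
abbreviation nonneg :: "('a \<Rightarrow> int) \<Rightarrow> bool" where
  "nonneg x \<equiv> \<forall>v\<in>nonsink G s. 0 \<le> x v"

lemma finite_nonsink: "finite (nonsink G s)"
  by simp

lemma sum_verts_sink: "(\<Sum>v\<in>verts G. f v) = f s + (\<Sum>v\<in>nonsink G s. f v)" for f :: "'a \<Rightarrow> int"
  using sink by (simp add: sum.remove)

text \<open>\<open>D\<close> is the length of a shortest walk to \<open>s\<close>, which exists by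
  strong connectivity; the first arc of such a walk brings the sink closer.\<close>

lemma sink_distance:
  obtains D :: "'a \<Rightarrow> nat"
  where "D s = 0" "\<And>v. v \<in> nonsink G s \<Longrightarrow> \<exists>w\<in>verts G. 0 < arc_mult G v w \<and> D w < D v"
proof -
  define D where "D v = (LEAST n. (v, s) \<in> arcs_ends G ^^ n)" for v
  show thesis
  proof
    have "(s, s) \<in> arcs_ends G ^^ 0" by simp
    then show "D s = 0"
      unfolding D_def by (metis Least_eq_0)
    fix v assume v: "v \<in> nonsink G s"
    then have "(v, s) \<in> (arcs_ends G)\<^sup>*"
      using strong sink by (auto simp: strongly_connected_def reachable_conv)
    then have "\<exists>n. (v, s) \<in> arcs_ends G ^^ n"
      by (simp add: rtrancl_power)
    then have Dv: "(v, s) \<in> arcs_ends G ^^ D v"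
      unfolding D_def by (rule LeastI_ex)
    \<comment> \<open>Length \<open>0\<close> would force \<open>v = s\<close>.\<close>
    with v obtain m where m: "D v = Suc m"
      by (cases "D v") auto
    with Dv obtain w where w: "(v, w) \<in> arcs_ends G" "(w, s) \<in> arcs_ends G ^^ m"
      by (metis relpow_Suc_D2)
    then have "D w \<le> m"
      unfolding D_def by (intro Least_le)
    moreover from w(1) obtain e where "e \<in> arcs G" "tail G e = v" "head G e = w"
      by (auto simp: arcs_ends_def arc_to_ends_def)
    then have "0 < arc_mult G v w" "w \<in> verts G"
      by (auto simp: arc_mult_def card_gt_0_iff)
    ultimately show "\<exists>w\<in>verts G. 0 < arc_mult G v w \<and> D w < D v"
      using m by auto
  qed
qed

text \<open>The potential decays geometrically in the distance to the sink, with a ratio exceeding every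
  outdegree, so that one arc towards the sink outweighs all other arcs out of a vertex.\<close>

lemma firing_potential:
  obtains h :: "'a \<Rightarrow> int"
  where "\<And>v. v \<in> nonsink G s \<Longrightarrow> 0 \<le> h v"
    "\<And>v. v \<in> nonsink G s \<Longrightarrow> 1 \<le> (\<Sum>w\<in>nonsink G s. h w * laplacian G w v)"
proof -
  obtain D :: "'a \<Rightarrow> nat" where D: "D s = 0"
    "\<And>v. v \<in> nonsink G s \<Longrightarrow> \<exists>w\<in>verts G. 0 < arc_mult G v w \<and> D w < D v"
    using sink_distance by blast
  \<comment> \<open>\<open>B\<close> exceeds every outdegree, and \<open>N\<close> bounds every
    distance, so that the natural subtraction \<open>N - D v\<close> is never truncated.\<close>
  define B where "B = 1 + (\<Sum>v\<in>verts G. odeg v)"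
  define N where "N = (\<Sum>v\<in>verts G. D v)"
  define g where "g v = B ^ (N - D v)" for v
  have B: "odeg v < B" if "v \<in> verts G" for v
    using member_le_sum[of v "verts G" odeg] that by (simp add: B_def)
  have B1: "1 \<le> B"
    by (simp add: B_def sum_nonneg)
  have N: "D v \<le> N" if "v \<in> verts G" for v
    using member_le_sum[of v "verts G" D] that by (simp add: N_def)
  have gs: "g s = B ^ N"
    by (simp add: g_def D)
  have g1: "1 \<le> g v" for v
    using B1 by (simp add: g_def)
  have g0: "0 \<le> g v" for v
    using g1[of v] by linarith
  show thesis
  proof
    fix v assume v: "v \<in> nonsink G s"
    show "0 \<le> B ^ N - g v"
      using B1 by (simp add: g_def power_increasing)
    obtain w where w: "w \<in> verts G" "0 < arc_mult G v w" "D w < D v"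
      using D v by blast
    have "B * g v = B ^ Suc (N - D v)"
      by (simp add: g_def)
    also have "\<dots> \<le> g w"
      unfolding g_def using w N[of v] v B1 by (intro power_increasing) auto
    finally have gw: "B * g v \<le> g w" .
    have "g w * 1 \<le> g w * int (arc_mult G v w)"
      using w g1[of w] by (intro mult_left_mono) auto
    also have "\<dots> \<le> (\<Sum>u\<in>verts G. g u * int (arc_mult G v u))"
      using w(1) by (intro member_le_sum) (simp_all add: g0)
    finally have le: "g w \<le> (\<Sum>u\<in>verts G. g u * int (arc_mult G v u))" by simp
    \<comment> \<open>Since \<open>g w\<close> is at least \<open>B * g v\<close>, the gap
      \<open>B - odeg v \<ge> 1\<close> remains after paying \<open>odeg v * g v\<close>.\<close>
    have "1 * 1 \<le> (B - odeg v) * g v"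
      using B[of v] v g1[of v] by (intro mult_mono) auto
    then have "1 \<le> g w - g v * odeg v"
      using gw by (simp add: algebra_simps)
    moreover have "(\<Sum>u\<in>verts G. g u * laplacian G u v)
        = g v * odeg v - (\<Sum>u\<in>verts G. g u * int (arc_mult G v u))"
    proof -
      have "(\<Sum>u\<in>verts G. g u * laplacian G u v)
        = (\<Sum>u\<in>verts G. (if u = v then g v * odeg v else 0) - g u * int (arc_mult G v u))"
        by (rule sum.cong) (auto simp: laplacian_alt right_diff_distrib)
      then show ?thesis using v by (simp add: sum_subtractf)
    qed
    \<comment> \<open>The constant \<open>B ^ N\<close> is the value of \<open>g\<close> at the
      sink, so the weight vanishes there and the sum extends to all vertices. There the columns sum
      to zero and the constant drops out.\<close>
    moreover have "(\<Sum>u\<in>nonsink G s. (B ^ N - g u) * laplacian G u v)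
        = (\<Sum>u\<in>verts G. (B ^ N - g u) * laplacian G u v)"
      by (simp add: sum_verts_sink gs)
    moreover have "(\<Sum>u\<in>verts G. (B ^ N - g u) * laplacian G u v) = - (\<Sum>u\<in>verts G. g u * laplacian G u v)"
    proof -
      have "(\<Sum>u\<in>verts G. (B ^ N - g u) * laplacian G u v)
          = B ^ N * (\<Sum>u\<in>verts G. laplacian G u v) - (\<Sum>u\<in>verts G. g u * laplacian G u v)"
        by (simp only: left_diff_distrib sum_subtractf sum_distrib_left)
      then show ?thesis using sum_laplacian_col[of v] v by simp
    qed
    ultimately show "1 \<le> (\<Sum>u\<in>nonsink G s. (B ^ N - g u) * laplacian G u v)"
      using le by linarith
  qed
qed

section \<open>Firing and stabilization\<close>

lemma fire_eq:
  assumes "v \<in> nonsink G s"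
  shows "fire G s v \<eta> = (\<lambda>w\<in>nonsink G s. \<eta> w - laplacian G w v)"
proof -
  have "mat_vec (nonsink G s) (laplacian G) (unit_vec_on (nonsink G s) v) w = laplacian G w v"
    if "w \<in> nonsink G s" for w
  proof -
    have "mat_vec (nonsink G s) (laplacian G) (unit_vec_on (nonsink G s) v) w
        = (\<Sum>u\<in>nonsink G s. laplacian G w u * (if u = v then 1 else 0))"
      using that unfolding mat_vec_def unit_vec_on_def by (auto intro: sum.cong)
    also have "\<dots> = laplacian G w v"
      by (rule sum_mult_unit[OF finite_nonsink assms])
    finally show ?thesis .
  qed
  then show ?thesis
    unfolding fire_def by (intro restrict_ext) simp
qed

lemma legal_fire_iff:
  "legal \<eta> \<xi> \<longleftrightarrow> (\<exists>v\<in>nonsink G s. odeg v \<le> \<eta> v \<and>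
     \<xi> = (\<lambda>w\<in>nonsink G s. \<eta> w - laplacian G w v))"
  by (auto simp: legal_fire_def fire_eq)

lemma legal_closed: "legal \<eta> \<xi> \<Longrightarrow> \<xi> \<in> carrier Z"
  by (auto simp: legal_fire_iff carrier_int_vecs)

lemma legals_closed: "legal\<^sup>*\<^sup>* \<eta> \<xi> \<Longrightarrow> \<eta> \<in> carrier Z \<Longrightarrow> \<xi> \<in> carrier Z"
  by (induction rule: rtranclp_induct) (auto intro: legal_closed)

text \<open>Extra grains keep an active vertex active, so firing commutes with adding a nonnegative
  vector.\<close>

lemma legal_add:
  assumes "legal \<eta> \<xi>" "nonneg \<alpha>"
  shows "legal (\<eta> \<otimes>\<^bsub>Z\<^esub> \<alpha>) (\<xi> \<otimes>\<^bsub>Z\<^esub> \<alpha>)"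
proof -
  obtain v where "v \<in> nonsink G s" "odeg v \<le> \<eta> v" "\<xi> = (\<lambda>w\<in>nonsink G s. \<eta> w - laplacian G w v)"
    using assms by (auto simp: legal_fire_iff)
  then show ?thesis
    unfolding legal_fire_iff using assms(2)
    by (intro bexI[of _ v]) (auto simp: mult_int_vecs fun_eq_iff add_increasing2)
qed

lemma legals_add: "legal\<^sup>*\<^sup>* \<eta> \<xi> \<Longrightarrow> nonneg \<alpha> \<Longrightarrow> legal\<^sup>*\<^sup>* (\<eta> \<otimes>\<^bsub>Z\<^esub> \<alpha>) (\<xi> \<otimes>\<^bsub>Z\<^esub> \<alpha>)"
  by (induction rule: rtranclp_induct) (auto dest: legal_add intro: rtranclp.rtrancl_into_rtrancl)

text \<open>The firing vertex is left with a nonnegative amount and every other vertex only gains,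
  so a bound that lies below both the sandpile and \<open>0\<close> survives.\<close>

lemma legal_lower_bound:
  assumes "legal \<eta> \<xi>" "\<And>v. v \<in> nonsink G s \<Longrightarrow> b v \<le> \<eta> v \<and> b v \<le> 0" "w \<in> nonsink G s"
  shows "b w \<le> \<xi> w"
proof -
  obtain v where "odeg v \<le> \<eta> v" "\<xi> = (\<lambda>w\<in>nonsink G s. \<eta> w - laplacian G w v)"
    using assms(1) by (auto simp: legal_fire_iff)
  then show ?thesis
    using assms(2)[OF assms(3)] assms(3) by (auto simp: laplacian_alt)
qed

lemma legals_nonneg: "legal\<^sup>*\<^sup>* \<eta> \<xi> \<Longrightarrow> nonneg \<eta> \<Longrightarrow> nonneg \<xi>"
  by (induction rule: rtranclp_induct) (auto dest: legal_lower_bound[where b = "\<lambda>_. 0"])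

lemma cls_eq_iff:
  assumes "\<eta> \<in> carrier Z" "\<xi> \<in> carrier Z"
  shows "cls \<eta> = cls \<xi> \<longleftrightarrow>
    (\<exists>z. \<forall>v\<in>nonsink G s. \<eta> v = \<xi> v + (\<Sum>w\<in>nonsink G s. laplacian G v w * z w))"
  using assms by (simp add: carrier_int_vecs column_span_coset_eq_iff)

text \<open>Firing \<open>v\<close> subtracts column \<open>v\<close> of the reduced Laplacian; the
  coefficient vector is the indicator of \<open>v\<close>.\<close>

lemma legal_cls:
  assumes "legal \<eta> \<xi>" "\<eta> \<in> carrier Z"
  shows "cls \<eta> = cls \<xi>"
proof -
  obtain v where v: "v \<in> nonsink G s" "\<xi> = (\<lambda>w\<in>nonsink G s. \<eta> w - laplacian G w v)"
    using assms by (auto simp: legal_fire_iff)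
  have "(\<Sum>w\<in>nonsink G s. laplacian G u w * (if w = v then 1 else 0)) = laplacian G u v" for u
    by (rule sum_mult_unit[OF finite_nonsink v(1)])
  then show ?thesis
    using v assms legal_closed[OF assms(1)]
    by (subst cls_eq_iff) (auto intro!: exI[of _ "\<lambda>w. if w = v then 1 else 0"])
qed

lemma legals_cls: "legal\<^sup>*\<^sup>* \<eta> \<xi> \<Longrightarrow> \<eta> \<in> carrier Z \<Longrightarrow> cls \<eta> = cls \<xi>"
proof (induction rule: rtranclp_induct)
  case (step \<xi> \<zeta>)
  then show ?case
    using legal_cls[of \<xi> \<zeta>] legals_closed[of \<eta> \<xi>] by simp
qed simp

section \<open>Existence and uniqueness of the stabilization\<close>

lemma stable_iff_no_legal: "stable G s \<eta> \<longleftrightarrow> (\<nexists>\<xi>. legal \<eta> \<xi>)"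
  by (auto simp: stable_def legal_fire_iff not_le)

lemma stable_legals: "legal\<^sup>*\<^sup>* \<eta> \<xi> \<Longrightarrow> stable G s \<eta> \<Longrightarrow> \<xi> = \<eta>"
  by (auto simp: stable_iff_no_legal elim: converse_rtranclpE)

text \<open>Each firing lowers the weight \<open>H\<close> by at least one, by the choice of the
  potential \<open>h\<close>. The sandpiles stay above \<open>b\<close>, and \<open>h\<close> is
  nonnegative, so \<open>H b\<close> bounds the weight from below.\<close>

lemma ex_stabilization: "\<exists>\<xi>. legal\<^sup>*\<^sup>* \<eta> \<xi> \<and> stable G s \<xi>"
proof -
  obtain h :: "'a \<Rightarrow> int" where h: "\<And>v. v \<in> nonsink G s \<Longrightarrow> 0 \<le> h v"
    "\<And>v. v \<in> nonsink G s \<Longrightarrow> 1 \<le> (\<Sum>w\<in>nonsink G s. h w * laplacian G w v)"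
    using firing_potential by blast
  define H where "H \<zeta> = (\<Sum>w\<in>nonsink G s. h w * \<zeta> w)" for \<zeta>
  define b where "b v = min 0 (\<eta> v)" for v
  \<comment> \<open>The bound \<open>b\<close> stays fixed by the initial sandpile while \<zeta>
    varies, so the measure of the induction is the same throughout.\<close>
  have "\<exists>\<xi>. legal\<^sup>*\<^sup>* \<zeta> \<xi> \<and> stable G s \<xi>" if "\<forall>v\<in>nonsink G s. b v \<le> \<zeta> v" for \<zeta>
    using that
  proof (induction "nat (H \<zeta> - H b)" arbitrary: \<zeta> rule: less_induct)
    case less
    show ?case
    proof (cases "stable G s \<zeta>")
      case False
      then obtain \<xi> where \<xi>: "legal \<zeta> \<xi>"
        by (auto simp: stable_iff_no_legal)
      then obtain v where v: "v \<in> nonsink G s" "\<xi> = (\<lambda>w\<in>nonsink G s. \<zeta> w - laplacian G w v)"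
        by (auto simp: legal_fire_iff)
      have bound: "\<forall>v\<in>nonsink G s. b v \<le> \<xi> v"
        using legal_lower_bound[OF \<xi>, of b] less.prems by (auto simp: b_def)
      have "H \<xi> = H \<zeta> - (\<Sum>w\<in>nonsink G s. h w * laplacian G w v)"
        by (simp add: H_def v(2) algebra_simps sum_subtractf)
      then have "H \<xi> < H \<zeta>"
        using h(2)[OF v(1)] by simp
      moreover have "H b \<le> H \<xi>"
        unfolding H_def using bound h by (auto intro!: sum_mono mult_left_mono)
      ultimately obtain \<theta> where "legal\<^sup>*\<^sup>* \<xi> \<theta>" "stable G s \<theta>"
        using less.hyps[of \<xi>] bound by auto
      then show ?thesis
        using \<xi> by (meson converse_rtranclp_into_rtranclp)
    qed auto
  qed
  then show ?thesis
    by (simp add: b_def)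
qed

text \<open>Of two distinct active vertices, each stays active when the other fires, and the two
  subtractions commute: a one-step diamond.\<close>

lemma confluent_legal: "confluentp legal"
proof (rule strong_confluentp_imp_confluentp, rule strong_confluentpI)
  fix x y z assume "legal x y" "legal x z"
  then obtain v w where v: "v \<in> nonsink G s" "odeg v \<le> x v"
      "y = (\<lambda>u\<in>nonsink G s. x u - laplacian G u v)"
    and w: "w \<in> nonsink G s" "odeg w \<le> x w"
      "z = (\<lambda>u\<in>nonsink G s. x u - laplacian G u w)"
    by (auto simp: legal_fire_iff)
  show "\<exists>u. legal\<^sup>*\<^sup>* y u \<and> legal\<^sup>=\<^sup>= z u"
  proof (cases "v = w")
    case False
    define u where "u = (\<lambda>u\<in>nonsink G s. x u - laplacian G u v - laplacian G u w)"
    have "odeg w \<le> y w" "odeg v \<le> z v"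
      using v w False by (auto simp: laplacian_alt)
    then have "legal y u" "legal z u"
      unfolding legal_fire_iff u_def using v w by (auto simp: fun_eq_iff)
    then show ?thesis by auto
  qed (use v w in auto)
qed

text \<open>By confluence two stable results have a common successor, and a stable sandpile has no
  successor but itself.\<close>

lemma stabilization_eqI:
  assumes "legal\<^sup>*\<^sup>* \<eta> \<xi>" "stable G s \<xi>"
  shows "stabilization G s \<eta> = \<xi>"
  unfolding stabilization_def
proof (rule the_equality)
  fix \<zeta> assume "legal\<^sup>*\<^sup>* \<eta> \<zeta> \<and> stable G s \<zeta>"
  then show "\<zeta> = \<xi>"
    using confluentpD[OF confluent_legal assms(1)] assms(2) stable_legals by metis
qed (use assms in blast)

lemma legals_stabilization: "legal\<^sup>*\<^sup>* \<eta> (stabilization G s \<eta>)"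
  and stable_stabilization: "stable G s (stabilization G s \<eta>)"
  using ex_stabilization[of \<eta>] stabilization_eqI by metis+

lemma stabilization_legals:
  assumes "legal\<^sup>*\<^sup>* \<eta> \<xi>"
  shows "stabilization G s \<eta> = stabilization G s \<xi>"
  using assms legals_stabilization stable_stabilization
  by (meson rtranclp_trans stabilization_eqI)

lemma stabilization_closed: "\<eta> \<in> carrier Z \<Longrightarrow> stabilization G s \<eta> \<in> carrier Z"
  using legals_closed legals_stabilization by blast

lemma cls_stabilization: "\<eta> \<in> carrier Z \<Longrightarrow> cls (stabilization G s \<eta>) = cls \<eta>"
  using legals_cls[OF legals_stabilization] by simp

lemma stabilization_le: "v \<in> nonsink G s \<Longrightarrow> stabilization G s \<eta> v < odeg v"
  using stable_stabilization by (simp add: stable_def)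

text \<open>A vertex holding enough grains for all its planned firings keeps enough of them, because the
  other firings only add grains to it.\<close>

lemma legals_multi_fire:
  fixes f :: "'a \<Rightarrow> nat"
  assumes "\<eta> \<in> carrier Z" "\<forall>v\<in>nonsink G s. int (f v) * odeg v \<le> \<eta> v"
  shows "legal\<^sup>*\<^sup>* \<eta> (\<lambda>v\<in>nonsink G s. \<eta> v - (\<Sum>w\<in>nonsink G s. laplacian G v w * int (f w)))"
  using assms
proof (induction "\<Sum>v\<in>nonsink G s. f v" arbitrary: f \<eta>)
  case 0
  then have "(\<lambda>v\<in>nonsink G s. \<eta> v - (\<Sum>w\<in>nonsink G s. laplacian G v w * int (f w))) = \<eta>"
    by (auto simp: carrier_int_vecs extensional_def fun_eq_iff)
  then show ?case by simp
next
  case (Suc n)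
  have "\<exists>v\<in>nonsink G s. f v \<noteq> 0"
    using Suc.hyps(2) by (metis Zero_not_Suc sum.neutral)
  then obtain v where v: "v \<in> nonsink G s" "0 < f v" by auto
  define g where "g = f(v := f v - 1)"
  define \<xi> where "\<xi> = (\<lambda>w\<in>nonsink G s. \<eta> w - laplacian G w v)"
  have f: "f w = g w + (if w = v then 1 else 0)" for w
    using v by (simp add: g_def)
  then have int_f: "int (f w) = int (g w) + (if w = v then 1 else 0)" for w
    by simp
  have n: "n = (\<Sum>v\<in>nonsink G s. g v)"
    using Suc.hyps(2) v(1) by (simp add: f sum.distrib)
  have "1 * odeg v \<le> int (f v) * odeg v"
    using v by (intro mult_right_mono) auto
  then have "odeg v \<le> \<eta> v"
    using Suc.prems(2)[rule_format, OF v(1)] by linarith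
  then have legal: "legal \<eta> \<xi>"
    unfolding legal_fire_iff \<xi>_def using v(1) by blast
  \<comment> \<open>Vertex \<open>v\<close> loses at most \<open>odeg v\<close>, exactly the amount
    by which its remaining requirement drops; the other vertices lose nothing.\<close>
  have "int (g w) * odeg w \<le> \<xi> w" if "w \<in> nonsink G s" for w
    using Suc.prems(2)[rule_format, OF that] that by (auto simp: \<xi>_def laplacian_alt f algebra_simps)
  then have "legal\<^sup>*\<^sup>* \<eta> (\<lambda>v\<in>nonsink G s. \<xi> v - (\<Sum>w\<in>nonsink G s. laplacian G v w * int (g w)))"
    using Suc.hyps(1)[OF n legal_closed[OF legal]] legal by (meson converse_rtranclp_into_rtranclp)
  moreover have "(\<lambda>u\<in>nonsink G s. \<xi> u - (\<Sum>w\<in>nonsink G s. laplacian G u w * int (g w)))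
      = (\<lambda>u\<in>nonsink G s. \<eta> u - (\<Sum>w\<in>nonsink G s. laplacian G u w * int (f w)))"
    by (rule restrict_ext)
      (simp add: \<xi>_def int_f distrib_left sum.distrib sum_mult_unit[OF finite_nonsink v(1)])
  ultimately show ?case by (simp only:)
qed


section \<open>Recurrent sandpiles\<close>

text \<open>Any \<sigma> stabilizes to some \<rho> that lies below \<tau>, and adding
  \<open>\<tau> - \<rho>\<close> gives \<tau>. These grains may be added before stabilizing, as the
  same firings stay legal.\<close>

lemma recurrentI:
  assumes "\<tau> \<in> carrier Z" "\<And>v. v \<in> nonsink G s \<Longrightarrow> odeg v - 1 \<le> \<tau> v"
  shows "stabilization G s \<tau> \<in> recurrents G s"
proof -
  have "accessible G s (stabilization G s \<tau>)"
    unfolding accessible_def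
  proof
    fix \<sigma> assume \<sigma>: "\<sigma> \<in> carrier Z"
    define \<rho> where "\<rho> = stabilization G s \<sigma>"
    define \<alpha> where "\<alpha> = (\<lambda>v\<in>nonsink G s. \<tau> v - \<rho> v)"
    have "\<rho> v \<le> \<tau> v" if "v \<in> nonsink G s" for v
      using assms(2)[OF that] stabilization_le[OF that, of \<sigma>] by (simp add: \<rho>_def)
    then have \<alpha>: "\<alpha> \<in> carrier Z" "nonneg \<alpha>"
      by (simp_all add: \<alpha>_def carrier_int_vecs)
    have "legal\<^sup>*\<^sup>* (\<sigma> \<otimes>\<^bsub>Z\<^esub> \<alpha>) (\<rho> \<otimes>\<^bsub>Z\<^esub> \<alpha>)"
      unfolding \<rho>_def using legals_add[OF legals_stabilization \<alpha>(2)] .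
    moreover have "\<rho> \<otimes>\<^bsub>Z\<^esub> \<alpha> = \<tau>"
      using assms(1) by (auto simp: \<alpha>_def mult_int_vecs carrier_int_vecs extensional_def fun_eq_iff)
    ultimately have "legal\<^sup>*\<^sup>* (\<sigma> \<otimes>\<^bsub>Z\<^esub> \<alpha>) (stabilization G s \<tau>)"
      using legals_stabilization by (metis rtranclp_trans)
    then show "\<exists>\<alpha>\<in>carrier Z. nonneg \<alpha> \<and> legal\<^sup>*\<^sup>* (\<sigma> \<otimes>\<^bsub>Z\<^esub> \<alpha>) (stabilization G s \<tau>)"
      using \<alpha> by blast
  qed
  then show ?thesis
    using assms(1) by (simp add: recurrents_def stabilization_closed stable_stabilization)
qed

lemma recurrent_closed: "\<eta> \<in> recurrents G s \<Longrightarrow> \<eta> \<in> carrier Z"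
  by (simp add: recurrents_def)

lemma recurrent_stable: "\<eta> \<in> recurrents G s \<Longrightarrow> stable G s \<eta>"
  by (simp add: recurrents_def)

lemma recurrentE:
  assumes "\<eta> \<in> recurrents G s" "\<sigma> \<in> carrier Z"
  obtains \<alpha> where "\<alpha> \<in> carrier Z" "nonneg \<alpha>" "legal\<^sup>*\<^sup>* (\<sigma> \<otimes>\<^bsub>Z\<^esub> \<alpha>) \<eta>"
  using assms by (auto simp: recurrents_def accessible_def)

text \<open>Accessibility from the zero sandpile suffices, because firing preserves
  nonnegativity.\<close>

lemma recurrent_nonneg:
  assumes "\<eta> \<in> recurrents G s"
  shows "nonneg \<eta>"
proof -
  have "(\<lambda>v\<in>nonsink G s. 0) \<in> carrier Z"
    by (simp add: carrier_int_vecs)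
  with assms obtain \<alpha> where "nonneg \<alpha>" "legal\<^sup>*\<^sup>* ((\<lambda>v\<in>nonsink G s. 0) \<otimes>\<^bsub>Z\<^esub> \<alpha>) \<eta>"
    by (rule recurrentE)
  then show ?thesis
    using legals_nonneg[of "(\<lambda>v\<in>nonsink G s. 0) \<otimes>\<^bsub>Z\<^esub> \<alpha>" \<eta>] by (simp add: mult_int_vecs)
qed

lemma add_closed: "\<eta> \<otimes>\<^bsub>Z\<^esub> \<xi> \<in> carrier Z"
  by (simp add: mult_int_vecs carrier_int_vecs)

lemma add_assoc: "(\<eta> \<otimes>\<^bsub>Z\<^esub> \<xi>) \<otimes>\<^bsub>Z\<^esub> \<zeta> = \<eta> \<otimes>\<^bsub>Z\<^esub> (\<xi> \<otimes>\<^bsub>Z\<^esub> \<zeta>)"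
  by (auto simp: mult_int_vecs add.assoc)

text \<open>The grains witnessing accessibility of \<eta> are enlarged by \<xi>. Only nonnegativity
  of \<xi> is asked, so the lemma also covers \<open>beta G s\<close>.\<close>

lemma recurrent_add_stabilization:
  assumes "\<eta> \<in> recurrents G s" "\<xi> \<in> carrier Z" "nonneg \<xi>"
  shows "stabilization G s (\<eta> \<otimes>\<^bsub>Z\<^esub> \<xi>) \<in> recurrents G s"
proof -
  have "accessible G s (stabilization G s (\<eta> \<otimes>\<^bsub>Z\<^esub> \<xi>))"
    unfolding accessible_def
  proof
    fix \<sigma> assume "\<sigma> \<in> carrier Z"
    with assms(1) obtain \<alpha> where \<alpha>: "\<alpha> \<in> carrier Z" "nonneg \<alpha>" "legal\<^sup>*\<^sup>* (\<sigma> \<otimes>\<^bsub>Z\<^esub> \<alpha>) \<eta>"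
      by (rule recurrentE)
    have "legal\<^sup>*\<^sup>* (\<sigma> \<otimes>\<^bsub>Z\<^esub> (\<alpha> \<otimes>\<^bsub>Z\<^esub> \<xi>)) (\<eta> \<otimes>\<^bsub>Z\<^esub> \<xi>)"
      using legals_add[OF \<alpha>(3) assms(3)] by (simp only: add_assoc)
    then have "legal\<^sup>*\<^sup>* (\<sigma> \<otimes>\<^bsub>Z\<^esub> (\<alpha> \<otimes>\<^bsub>Z\<^esub> \<xi>)) (stabilization G s (\<eta> \<otimes>\<^bsub>Z\<^esub> \<xi>))"
      using legals_stabilization by (rule rtranclp_trans)
    moreover have "nonneg (\<alpha> \<otimes>\<^bsub>Z\<^esub> \<xi>)"
      using \<alpha>(2) assms(3) by (simp add: mult_int_vecs)
    ultimately show "\<exists>\<alpha>\<in>carrier Z. nonneg \<alpha> \<and>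
        legal\<^sup>*\<^sup>* (\<sigma> \<otimes>\<^bsub>Z\<^esub> \<alpha>) (stabilization G s (\<eta> \<otimes>\<^bsub>Z\<^esub> \<xi>))"
      using add_closed by blast
  qed
  then show ?thesis
    by (simp add: recurrents_def stabilization_closed stable_stabilization add_closed)
qed

text \<open>Take \<open>\<epsilon> = c - c\<degree>\<close> for a large constant \<open>c\<close>. A recurrent \<open>\<eta>\<close> is reached from some
  \<open>c + \<alpha>\<close>; firing \<open>c + \<alpha> + \<epsilon>\<close> in two ways, along \<open>c + \<alpha> \<rightarrow> \<eta>\<close> and along \<open>c \<rightarrow> c\<degree>\<close>,
  shows that \<open>\<eta> + \<epsilon>\<close> and \<open>c + \<alpha>\<close> have the same stabilization.\<close>

lemma absorbed_vector:
  obtains \<epsilon> where "\<epsilon> \<in> carrier Z" "\<And>v. v \<in> nonsink G s \<Longrightarrow> 1 \<le> \<epsilon> v" "\<epsilon> \<in> reduced_lattice G s"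
    "\<And>\<eta>. \<eta> \<in> recurrents G s \<Longrightarrow> stabilization G s (\<eta> \<otimes>\<^bsub>Z\<^esub> \<epsilon>) = \<eta>"
proof -
  \<comment> \<open>The constant is at least every outdegree, whereas \<open>c'\<close> is stable
    and so strictly below; hence \<epsilon> is at least \<open>1\<close> everywhere.\<close>
  define c where "c = (\<lambda>v\<in>nonsink G s. \<Sum>w\<in>verts G. odeg w)"
  define c' where "c' = stabilization G s c"
  define \<epsilon> where "\<epsilon> = (\<lambda>v\<in>nonsink G s. c v - c' v)"
  have c: "c \<in> carrier Z"
    by (simp add: c_def carrier_int_vecs)
  then have c': "c' \<in> carrier Z"
    by (simp add: c'_def stabilization_closed)
  have \<epsilon>: "\<epsilon> \<in> carrier Z"
    by (simp add: \<epsilon>_def carrier_int_vecs)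
  have pos: "1 \<le> \<epsilon> v" if "v \<in> nonsink G s" for v
    using stabilization_le[OF that, of c] member_le_sum[of v "verts G" odeg] that
    by (simp add: \<epsilon>_def c_def c'_def)
  show thesis
  proof
    have "cls c = cls c'"
      using cls_stabilization[OF c] by (simp add: c'_def)
    then obtain z where "\<forall>v\<in>nonsink G s. c v = c' v + (\<Sum>w\<in>nonsink G s. laplacian G v w * z w)"
      using cls_eq_iff[OF c c'] by blast
    then show "\<epsilon> \<in> reduced_lattice G s"
      by (auto simp: column_span_iff \<epsilon>_def intro!: exI[of _ z])
    fix \<eta> assume \<eta>: "\<eta> \<in> recurrents G s"
    then obtain \<alpha> where \<alpha>: "\<alpha> \<in> carrier Z" "nonneg \<alpha>" "legal\<^sup>*\<^sup>* (c \<otimes>\<^bsub>Z\<^esub> \<alpha>) \<eta>"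
      using c by (rule recurrentE)
    have "0 \<le> \<epsilon> v" if "v \<in> nonsink G s" for v
      using pos[OF that] by linarith
    then have nn: "nonneg \<epsilon>" "nonneg (\<alpha> \<otimes>\<^bsub>Z\<^esub> \<epsilon>)"
      using \<alpha>(2) by (auto simp: mult_int_vecs)
    have "legal\<^sup>*\<^sup>* (c \<otimes>\<^bsub>Z\<^esub> (\<alpha> \<otimes>\<^bsub>Z\<^esub> \<epsilon>)) (\<eta> \<otimes>\<^bsub>Z\<^esub> \<epsilon>)"
      using legals_add[OF \<alpha>(3) nn(1)] by (simp only: add_assoc)
    from stabilization_legals[OF this]
    have "stabilization G s (\<eta> \<otimes>\<^bsub>Z\<^esub> \<epsilon>) = stabilization G s (c \<otimes>\<^bsub>Z\<^esub> (\<alpha> \<otimes>\<^bsub>Z\<^esub> \<epsilon>))"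
      by simp
    moreover have "legal\<^sup>*\<^sup>* (c \<otimes>\<^bsub>Z\<^esub> (\<alpha> \<otimes>\<^bsub>Z\<^esub> \<epsilon>)) (c' \<otimes>\<^bsub>Z\<^esub> (\<alpha> \<otimes>\<^bsub>Z\<^esub> \<epsilon>))"
      unfolding c'_def using legals_stabilization nn(2) by (rule legals_add)
    \<comment> \<open>Firing \<open>c\<close> down to \<open>c'\<close> uses up exactly the added
      \<epsilon>, which brings back the start of the route to \<eta>.\<close>
    moreover have "c' \<otimes>\<^bsub>Z\<^esub> (\<alpha> \<otimes>\<^bsub>Z\<^esub> \<epsilon>) = c \<otimes>\<^bsub>Z\<^esub> \<alpha>"
      by (auto simp: mult_int_vecs \<epsilon>_def intro!: restrict_ext)
    ultimately have "legal\<^sup>*\<^sup>* (c \<otimes>\<^bsub>Z\<^esub> (\<alpha> \<otimes>\<^bsub>Z\<^esub> \<epsilon>)) \<eta>"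
      and eq: "stabilization G s (\<eta> \<otimes>\<^bsub>Z\<^esub> \<epsilon>) = stabilization G s (c \<otimes>\<^bsub>Z\<^esub> (\<alpha> \<otimes>\<^bsub>Z\<^esub> \<epsilon>))"
      using \<alpha>(3) by auto
    then show "stabilization G s (\<eta> \<otimes>\<^bsub>Z\<^esub> \<epsilon>) = \<eta>"
      using stabilization_eqI recurrent_stable[OF \<eta>] by simp
  qed (use \<epsilon> pos in auto)
qed

text \<open>Positive multiples of one absorbed vector grow beyond any bound, and they are absorbed
  one copy at a time.\<close>

lemma absorbed_vector_ge:
  fixes N :: "'a \<Rightarrow> int"
  shows "\<exists>\<epsilon>\<in>carrier Z. (\<forall>v\<in>nonsink G s. N v \<le> \<epsilon> v) \<and> \<epsilon> \<in> reduced_lattice G s \<and>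
    (\<forall>\<eta>\<in>recurrents G s. stabilization G s (\<eta> \<otimes>\<^bsub>Z\<^esub> \<epsilon>) = \<eta>)"
proof -
  obtain \<epsilon> where \<epsilon>: "\<epsilon> \<in> carrier Z" "\<And>v. v \<in> nonsink G s \<Longrightarrow> 1 \<le> \<epsilon> v" "\<epsilon> \<in> reduced_lattice G s"
    "\<And>\<eta>. \<eta> \<in> recurrents G s \<Longrightarrow> stabilization G s (\<eta> \<otimes>\<^bsub>Z\<^esub> \<epsilon>) = \<eta>"
    using absorbed_vector by blast
  have nn: "nonneg \<epsilon>"
  proof
    fix v assume "v \<in> nonsink G s"
    from \<epsilon>(2)[OF this] show "0 \<le> \<epsilon> v" by linarith
  qed
  define m where "m k = (\<lambda>v\<in>nonsink G s. int k * \<epsilon> v)" for k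
  have m: "m k \<in> carrier Z" for k
    by (simp add: m_def carrier_int_vecs)
  have m_Suc: "m (Suc k) = \<epsilon> \<otimes>\<^bsub>Z\<^esub> m k" for k
    by (auto simp: m_def mult_int_vecs algebra_simps intro!: restrict_ext)
  have m_nn: "nonneg (m k)" for k
    using nn by (simp add: m_def)
  have lattice: "m k \<in> reduced_lattice G s" for k
  proof (induction k)
    case 0
    show ?case
      by (auto simp: m_def column_span_iff extensional_def intro!: exI[of _ "\<lambda>_. 0"])
  next
    case (Suc k)
    then show ?case
      unfolding m_Suc by (rule subgroup.m_closed[OF subgroup_column_span \<epsilon>(3)])
  qed
  have absorb: "stabilization G s (\<eta> \<otimes>\<^bsub>Z\<^esub> m k) = \<eta>" if \<eta>: "\<eta> \<in> recurrents G s" for \<eta> k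
  proof (induction k)
    case 0
    have "\<eta> \<otimes>\<^bsub>Z\<^esub> m 0 = \<eta>"
      using recurrent_closed[OF \<eta>]
      by (auto simp: m_def mult_int_vecs carrier_int_vecs extensional_def fun_eq_iff)
    then show ?case
      using stabilization_eqI[OF rtranclp.rtrancl_refl recurrent_stable[OF \<eta>]] by simp
  next
    case (Suc k)
    have "legal\<^sup>*\<^sup>* (\<eta> \<otimes>\<^bsub>Z\<^esub> \<epsilon>) \<eta>"
      using legals_stabilization[of "\<eta> \<otimes>\<^bsub>Z\<^esub> \<epsilon>"] \<epsilon>(4)[OF \<eta>] by simp
    from stabilization_legals[OF legals_add[OF this m_nn[of k]]] Suc.IH show ?case
      by (simp only: m_Suc add_assoc)
  qed
  \<comment> \<open>\<open>k\<close> bounds each \<open>N v\<close>, and every entry of \<epsilon>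
    is at least \<open>1\<close>.\<close>
  define k where "k = nat (\<Sum>v\<in>nonsink G s. \<bar>N v\<bar>)"
  have "N v \<le> m k v" if v: "v \<in> nonsink G s" for v
  proof -
    have "\<bar>N v\<bar> \<le> int k"
      unfolding k_def using member_le_sum[of v "nonsink G s" "\<lambda>v. \<bar>N v\<bar>"] v by simp
    moreover have "int k * 1 \<le> int k * \<epsilon> v"
      using \<epsilon>(2)[OF v] by (intro mult_left_mono) auto
    ultimately show ?thesis
      using v by (simp add: m_def)
  qed
  then show ?thesis
    using m[of k] lattice[of k] absorb[of _ k] by blast
qed

section \<open>The unique recurrent representative of each class\<close>

lemma cls_add_lattice:
  assumes "\<eta> \<in> carrier Z" "\<epsilon> \<in> reduced_lattice G s"
  shows "cls (\<eta> \<otimes>\<^bsub>Z\<^esub> \<epsilon>) = cls \<eta>"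
  using assms by (subst cls_eq_iff) (auto simp: carrier_int_vecs column_span_iff mult_int_vecs)

text \<open>A lattice vector lifts \<open>x\<close> to at least \<open>odeg v - 1\<close> at every
  vertex without changing its class; then \<open>recurrentI\<close> applies.\<close>

lemma ex_recurrent:
  assumes "x \<in> carrier Z"
  shows "\<exists>\<eta>\<in>recurrents G s. cls \<eta> = cls x"
proof -
  obtain \<epsilon> where \<epsilon>: "\<epsilon> \<in> carrier Z" "\<forall>v\<in>nonsink G s. odeg v - 1 - x v \<le> \<epsilon> v"
      "\<epsilon> \<in> reduced_lattice G s"
    using absorbed_vector_ge[of "\<lambda>v. odeg v - 1 - x v"] by blast
  have "odeg v - 1 \<le> (x \<otimes>\<^bsub>Z\<^esub> \<epsilon>) v" if "v \<in> nonsink G s" for v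
    using \<epsilon>(2)[rule_format, OF that] that by (simp add: mult_int_vecs)
  then have "stabilization G s (x \<otimes>\<^bsub>Z\<^esub> \<epsilon>) \<in> recurrents G s"
    by (rule recurrentI[OF add_closed])
  moreover have "cls (stabilization G s (x \<otimes>\<^bsub>Z\<^esub> \<epsilon>)) = cls x"
    using cls_stabilization[OF add_closed] cls_add_lattice[OF assms \<epsilon>(3)] by simp
  ultimately show ?thesis by blast
qed

lemma recurrent_unique:
  assumes \<eta>: "\<eta> \<in> recurrents G s" and \<xi>: "\<xi> \<in> recurrents G s" and eq: "cls \<eta> = cls \<xi>"
  shows "\<eta> = \<xi>"
proof -
  obtain z where z: "\<And>v. v \<in> nonsink G s \<Longrightarrow> \<eta> v = \<xi> v + (\<Sum>w\<in>nonsink G s. laplacian G v w * z w)"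
    using eq cls_eq_iff[OF recurrent_closed[OF \<eta>] recurrent_closed[OF \<xi>]] by blast
  \<comment> \<open>Enough grains for \<bar>z v\<bar> firings at \<open>v\<close>, which covers both
    the positive and the negative part of \<open>z\<close>.\<close>
  define N where "N v = \<bar>z v\<bar> * odeg v" for v
  obtain \<epsilon> where \<epsilon>: "\<epsilon> \<in> carrier Z" "\<forall>v\<in>nonsink G s. N v \<le> \<epsilon> v"
      "\<forall>\<eta>\<in>recurrents G s. stabilization G s (\<eta> \<otimes>\<^bsub>Z\<^esub> \<epsilon>) = \<eta>"
    using absorbed_vector_ge[of N] by blast
  define fired where "fired \<zeta> f =
    (\<lambda>v\<in>nonsink G s. (\<zeta> \<otimes>\<^bsub>Z\<^esub> \<epsilon>) v - (\<Sum>w\<in>nonsink G s. laplacian G v w * int (f w)))"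
    for \<zeta> and f :: "'a \<Rightarrow> nat"
  have fired: "stabilization G s (fired \<zeta> f) = \<zeta>"
    if \<zeta>: "\<zeta> \<in> recurrents G s" and f: "\<And>v. int (f v) \<le> \<bar>z v\<bar>" for \<zeta> f
  proof -
    have "int (f v) * odeg v \<le> (\<zeta> \<otimes>\<^bsub>Z\<^esub> \<epsilon>) v" if v: "v \<in> nonsink G s" for v
    proof -
      have "int (f v) * odeg v \<le> N v"
        unfolding N_def using f by (intro mult_right_mono) auto
      moreover have "0 \<le> \<zeta> v"
        using recurrent_nonneg[OF \<zeta>] v by blast
      ultimately show ?thesis
        using \<epsilon>(2)[rule_format, OF v] v by (simp add: mult_int_vecs)
    qed
    then have "legal\<^sup>*\<^sup>* (\<zeta> \<otimes>\<^bsub>Z\<^esub> \<epsilon>) (fired \<zeta> f)"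
      unfolding fired_def by (intro legals_multi_fire add_closed) blast
    from stabilization_legals[OF this] show ?thesis
      using \<epsilon>(3)[rule_format, OF \<zeta>] by simp
  qed
  \<comment> \<open>Splitting \<open>z\<close> into its two parts puts the positive firings on the
    side of \<eta> and the negative ones on the side of \<xi>, so both end in the same
    sandpile.\<close>
  have "(\<Sum>w\<in>nonsink G s. laplacian G v w * z w)
      = (\<Sum>w\<in>nonsink G s. laplacian G v w * int (nat (z w)))
        - (\<Sum>w\<in>nonsink G s. laplacian G v w * int (nat (- z w)))" for v
    unfolding sum_subtractf[symmetric] right_diff_distrib[symmetric]
    by (rule sum.cong) auto
  then have "fired \<eta> (\<lambda>v. nat (z v)) = fired \<xi> (\<lambda>v. nat (- z v))"
    unfolding fired_def by (intro restrict_ext) (simp add: z mult_int_vecs)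
  moreover have "stabilization G s (fired \<eta> (\<lambda>v. nat (z v))) = \<eta>"
      "stabilization G s (fired \<xi> (\<lambda>v. nat (- z v))) = \<xi>"
    using fired \<eta> \<xi> by auto
  ultimately show ?thesis by simp
qed

abbreviation "K \<equiv> critical_group G s"
abbreviation "S \<equiv> sandpile_group G s"
abbreviation "B \<equiv> generate K {beta_class G s}"

section \<open>The sandpile group\<close>

lemma comm_group_critical: "comm_group K"
  unfolding critical_group_def
  by (rule comm_group.abelian_FactGroup[OF comm_group_int_vecs subgroup_column_span])

lemma group_critical: "group K"
  using comm_group_critical comm_group.axioms(2) by blast

lemma cls_hom: "group_hom Z K (\<lambda>x. cls x)"
  unfolding group_hom_def group_hom_axioms_def critical_group_def
  using normal.r_coset_hom_Mod[OF comm_group.subgroup_imp_normal[OF comm_group_int_vecs subgroup_column_span]]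
    group_critical group_int_vecs
  by (auto simp: critical_group_def)

lemma carrier_critical: "carrier K = (\<lambda>x. cls x) ` carrier Z"
  by (simp add: critical_group_def carrier_FactGroup)

lemma cls_sandpile_add:
  assumes "\<eta> \<in> carrier Z" "\<xi> \<in> carrier Z"
  shows "cls (sandpile_add G s \<eta> \<xi>) = cls \<eta> \<otimes>\<^bsub>K\<^esub> cls \<xi>"
  using group_hom.hom_mult[OF cls_hom assms] cls_stabilization[OF add_closed]
  by (simp add: sandpile_add_def)

lemma sandpile_add_closed:
  assumes "\<eta> \<in> recurrents G s" "\<xi> \<in> recurrents G s"
  shows "sandpile_add G s \<eta> \<xi> \<in> recurrents G s"
  unfolding sandpile_add_def
  using recurrent_add_stabilization[OF assms(1) recurrent_closed[OF assms(2)] recurrent_nonneg[OF assms(2)]] .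

lemma bij_cls: "bij_betw (\<lambda>x. cls x) (recurrents G s) (carrier K)"
proof (rule bij_betw_imageI)
  show "inj_on (\<lambda>x. cls x) (recurrents G s)"
    by (rule inj_onI) (rule recurrent_unique)
  show "(\<lambda>x. cls x) ` recurrents G s = carrier K"
  proof
    show "(\<lambda>x. cls x) ` recurrents G s \<subseteq> carrier K"
      unfolding carrier_critical using recurrent_closed by blast
    show "carrier K \<subseteq> (\<lambda>x. cls x) ` recurrents G s"
    proof
      fix C assume "C \<in> carrier K"
      then obtain x where x: "x \<in> carrier Z" "C = cls x"
        unfolding carrier_critical by blast
      then obtain \<eta> where "\<eta> \<in> recurrents G s" "cls \<eta> = cls x"
        using ex_recurrent[OF x(1)] by blast
      then show "C \<in> (\<lambda>x. cls x) ` recurrents G s"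
        unfolding x(2) by (metis image_eqI)
    qed
  qed
qed

lemma cls_closed: "\<eta> \<in> carrier Z \<Longrightarrow> cls \<eta> \<in> carrier K"
  unfolding carrier_critical by (rule imageI)

text \<open>The recurrent sandpile in the trivial class is neutral, because both products are
  recurrent and have the class of \<eta>.\<close>

lemma sandpile_identity:
  "sandpile_identity G s \<in> recurrents G s" "cls (sandpile_identity G s) = \<one>\<^bsub>K\<^esub>"
proof -
  interpret K: group K by (rule group_critical)
  have "\<one>\<^bsub>K\<^esub> \<in> (\<lambda>x. cls x) ` recurrents G s"
    using bij_betw_imp_surj_on[OF bij_cls] by simp
  then obtain e where e: "e \<in> recurrents G s" "cls e = \<one>\<^bsub>K\<^esub>"
    by (metis (no_types, lifting) imageE)
  have "sandpile_identity G s = e"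
    unfolding sandpile_identity_def
  proof (rule the_equality)
    have "sandpile_add G s e \<eta> = \<eta> \<and> sandpile_add G s \<eta> e = \<eta>" if \<eta>: "\<eta> \<in> recurrents G s" for \<eta>
    proof
      have c: "cls \<eta> \<in> carrier K" "e \<in> carrier Z" "\<eta> \<in> carrier Z"
        using cls_closed recurrent_closed \<eta> e(1) by auto
      show "sandpile_add G s e \<eta> = \<eta>"
        by (rule recurrent_unique[OF sandpile_add_closed[OF e(1) \<eta>] \<eta>])
          (simp only: cls_sandpile_add[OF c(2,3)] e(2) K.l_one[OF c(1)])
      show "sandpile_add G s \<eta> e = \<eta>"
        by (rule recurrent_unique[OF sandpile_add_closed[OF \<eta> e(1)] \<eta>])
          (simp only: cls_sandpile_add[OF c(3,2)] e(2) K.r_one[OF c(1)])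
    qed
    with e(1) show "e \<in> recurrents G s \<and>
        (\<forall>\<eta>\<in>recurrents G s. sandpile_add G s e \<eta> = \<eta> \<and> sandpile_add G s \<eta> e = \<eta>)"
      by blast
    \<comment> \<open>The product of \<open>e'\<close> and \<open>e\<close> equals both of
      them.\<close>
    then show "e' = e" if "e' \<in> recurrents G s \<and>
        (\<forall>\<eta>\<in>recurrents G s. sandpile_add G s e' \<eta> = \<eta> \<and> sandpile_add G s \<eta> e' = \<eta>)" for e'
      using that by metis
  qed
  with e show "sandpile_identity G s \<in> recurrents G s" "cls (sandpile_identity G s) = \<one>\<^bsub>K\<^esub>"
    by simp_all
qed

lemma sandpile_group_simps:
  "carrier S = recurrents G s" "\<eta> \<otimes>\<^bsub>S\<^esub> \<xi> = sandpile_add G s \<eta> \<xi>" "\<one>\<^bsub>S\<^esub> = sandpile_identity G s"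
  by (simp_all add: sandpile_group_def)

text \<open>Each axiom is pulled back from the critical group: both sides are recurrent with equal
  classes, so \<open>recurrent_unique\<close> identifies them.\<close>

lemma group_sandpile: "group S"
proof -
  interpret K: group K by (rule group_critical)
  note closed = sandpile_add_closed recurrent_closed cls_closed
  note cls_add = cls_sandpile_add[OF recurrent_closed recurrent_closed]
  show ?thesis
  proof (rule groupI; unfold sandpile_group_simps)
    fix \<eta> \<xi> assume \<eta>: "\<eta> \<in> recurrents G s" and \<xi>: "\<xi> \<in> recurrents G s"
    then show "sandpile_add G s \<eta> \<xi> \<in> recurrents G s"
      by (rule sandpile_add_closed)
    fix \<zeta> assume \<zeta>: "\<zeta> \<in> recurrents G s"
    show "sandpile_add G s (sandpile_add G s \<eta> \<xi>) \<zeta> = sandpile_add G s \<eta> (sandpile_add G s \<xi> \<zeta>)"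
      by (rule recurrent_unique)
        (simp_all add: closed cls_add \<eta> \<xi> \<zeta> K.m_assoc)
  next
    show "sandpile_identity G s \<in> recurrents G s"
      by (rule sandpile_identity)
  next
    fix \<eta> assume \<eta>: "\<eta> \<in> recurrents G s"
    show "sandpile_add G s (sandpile_identity G s) \<eta> = \<eta>"
      by (rule recurrent_unique)
        (simp_all add: closed cls_add \<eta> sandpile_identity K.l_one)
    have "inv\<^bsub>K\<^esub> (cls \<eta>) \<in> (\<lambda>x. cls x) ` recurrents G s"
      using bij_betw_imp_surj_on[OF bij_cls] by (simp add: closed \<eta>)
    then obtain \<xi> where \<xi>: "\<xi> \<in> recurrents G s" "cls \<xi> = inv\<^bsub>K\<^esub> (cls \<eta>)"
      by (metis (no_types, lifting) imageE)
    have "sandpile_add G s \<xi> \<eta> = sandpile_identity G s"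
      by (rule recurrent_unique)
        (simp_all add: closed cls_add \<eta> \<xi> sandpile_identity K.l_inv)
    with \<xi>(1) show "\<exists>\<xi>\<in>recurrents G s. sandpile_add G s \<xi> \<eta> = sandpile_identity G s"
      by blast
  qed
qed

lemma group_hom_sandpile_critical: "group_hom S K (\<lambda>x. cls x)"
  unfolding group_hom_def group_hom_axioms_def hom_def
  using group_sandpile group_critical
  by (auto simp: sandpile_group_simps cls_closed recurrent_closed cls_sandpile_add)

lemma beta_closed: "beta G s \<in> carrier Z"
  by (simp add: beta_def carrier_int_vecs)

lemma gamma: "gamma G s \<in> recurrents G s" "cls (gamma G s) = beta_class G s"
proof -
  show "gamma G s \<in> recurrents G s"
    unfolding gamma_def
    by (rule recurrent_add_stabilization[OF sandpile_identity(1) beta_closed]) (simp add: beta_def)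
  interpret K: group K by (rule group_critical)
  \<comment> \<open>Here \<open>sandpile_add\<close> is applied to \<open>beta G s\<close>, which
    need not be recurrent; its class formula holds for all sandpiles.\<close>
  have "cls (gamma G s) = cls (sandpile_identity G s) \<otimes>\<^bsub>K\<^esub> cls (beta G s)"
    unfolding gamma_def sandpile_add_def[symmetric]
    by (rule cls_sandpile_add[OF recurrent_closed[OF sandpile_identity(1)] beta_closed])
  then show "cls (gamma G s) = beta_class G s"
    by (simp add: sandpile_identity(2) cls_closed beta_closed beta_class_def)
qed

section \<open>The common quotient\<close>

lemma beta_class_closed: "beta_class G s \<in> carrier K"
  unfolding beta_class_def by (rule cls_closed[OF beta_closed])

lemma normal_B: "B \<lhd> K"
  by (intro comm_group.subgroup_imp_normal comm_group_critical group.generate_is_subgroup group_critical)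
    (simp add: beta_class_closed)

lemma group_hom_quotient: "group_hom K (K Mod B) (\<lambda>C. B #>\<^bsub>K\<^esub> C)"
  unfolding group_hom_def group_hom_axioms_def
  using group_critical normal.factorgroup_is_group[OF normal_B] normal.r_coset_hom_Mod[OF normal_B]
  by blast

lemma quotient_eq_one_iff:
  assumes "C \<in> carrier K"
  shows "B #>\<^bsub>K\<^esub> C = \<one>\<^bsub>K Mod B\<^esub> \<longleftrightarrow> C \<in> B"
  using group.coset_join1[OF group_critical _ assms] group.coset_join2[OF group_critical assms]
    normal_imp_subgroup[OF normal_B]
  by auto

lemma group_hom_comp:
  assumes "group_hom H K f"
  shows "group_hom H (K Mod B) (\<lambda>x. B #>\<^bsub>K\<^esub> f x)"
  using group_hom.homh[OF assms] group_hom.homh[OF group_hom_quotient] assms group_hom_quotient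
  unfolding group_hom_def group_hom_axioms_def
  by (auto simp: hom_def Pi_iff)

lemma sandpile_quotient_iso: "S Mod generate S {gamma G s} \<cong> K Mod B"
proof (rule group_hom.Mod_iso[OF group_hom_comp[OF group_hom_sandpile_critical]])
  show "(\<lambda>x. B #>\<^bsub>K\<^esub> cls x) ` carrier S = carrier (K Mod B)"
    using bij_betw_imp_surj_on[OF bij_cls]
    by (simp only: carrier_FactGroup sandpile_group_simps image_image[symmetric])
  have sub: "{gamma G s} \<subseteq> carrier S"
    by (simp add: sandpile_group_simps gamma)
  show incl: "generate S {gamma G s} \<subseteq> carrier S"
    using group.generate_incl[OF group_sandpile sub] .
  fix \<eta> assume \<eta>: "\<eta> \<in> carrier S"
  \<comment> \<open>Generator goes to generator, and the class map is injective on recurrents, so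
    membership in the cyclic subgroup transfers both ways.\<close>
  have "(\<lambda>x. cls x) ` generate S {gamma G s} = B"
    using group_hom.generate_img[OF group_hom_sandpile_critical sub] by (simp add: gamma)
  then have "cls \<eta> \<in> B \<longleftrightarrow> \<eta> \<in> generate S {gamma G s}"
    using inj_on_image_mem_iff[OF bij_betw_imp_inj_on[OF bij_cls]] \<eta> incl
    by (metis (no_types, lifting) sandpile_group_simps(1))
  then show "B #>\<^bsub>K\<^esub> cls \<eta> = \<one>\<^bsub>K Mod B\<^esub> \<longleftrightarrow> \<eta> \<in> generate S {gamma G s}"
    using quotient_eq_one_iff[OF cls_closed] \<eta> recurrent_closed by (simp add: sandpile_group_simps)
qed

text \<open>The cyclic subgroup consists of the integer powers of the class of \<open>beta\<close>,
  so membership becomes a linear system with one further unknown \<open>k\<close>.\<close>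

lemma cls_in_generate_iff:
  assumes "x \<in> carrier Z"
  shows "cls x \<in> B \<longleftrightarrow> (\<exists>k z. \<forall>v\<in>nonsink G s.
    x v = k * int (arc_mult G s v) + (\<Sum>w\<in>nonsink G s. laplacian G v w * z w))"
proof -
  have pow: "beta_class G s [^]\<^bsub>K\<^esub> (k::int) = cls (\<lambda>v\<in>nonsink G s. k * int (arc_mult G s v))" for k
  proof -
    have "beta G s [^]\<^bsub>Z\<^esub> k = (\<lambda>v\<in>nonsink G s. k * int (arc_mult G s v))"
      using beta_closed by (auto simp: carrier_int_vecs int_pow_int_vecs beta_def)
    then show ?thesis
      using group_hom.hom_int_pow[OF cls_hom beta_closed, of k] by (simp add: beta_class_def)
  qed
  have "cls x \<in> B \<longleftrightarrow> (\<exists>k. cls x = cls (\<lambda>v\<in>nonsink G s. k * int (arc_mult G s v)))"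
    unfolding group.generate_pow[OF group_critical beta_class_closed] pow by blast
  moreover have "(\<lambda>v\<in>nonsink G s. k * int (arc_mult G s v)) \<in> carrier Z" for k
    by (simp add: carrier_int_vecs)
  ultimately show ?thesis
    by (simp add: cls_eq_iff[OF assms])
qed

text \<open>Column \<open>s\<close> of the total Laplacian restricts to \<open>- \<beta>\<close>, so adjoining it to the reduced
  lattice amounts to passing to the quotient by \<open>\<beta>\<close>; the entry at \<open>s\<close> is determined by the zero sum.\<close>

lemma zero_sum_column_span_iff:
  assumes "x \<in> carrier (zero_sum_vecs (verts G))"
  shows "x \<in> column_span (verts G) (laplacian G) \<longleftrightarrow> cls (restrict x (nonsink G s)) \<in> B"
proof -
  have x: "x \<in> extensional (verts G)" and sum_x: "(\<Sum>v\<in>verts G. x v) = 0"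
    using assms by (auto simp: zero_sum_vecs_def carrier_int_vecs)
  have split: "(\<Sum>w\<in>verts G. laplacian G v w * y w)
      = - y s * int (arc_mult G s v) + (\<Sum>w\<in>nonsink G s. laplacian G v w * y w)"
    if "v \<in> nonsink G s" for v y
    using that by (simp add: sum_verts_sink laplacian_alt)
  have "x \<in> column_span (verts G) (laplacian G)
    \<longleftrightarrow> (\<exists>y. \<forall>v\<in>verts G. x v = (\<Sum>w\<in>verts G. laplacian G v w * y w))"
    using x by (simp add: column_span_iff)
  moreover have "\<dots> \<longleftrightarrow> (\<exists>y. \<forall>v\<in>nonsink G s. x v = (\<Sum>w\<in>verts G. laplacian G v w * y w))"
  \<comment> \<open>The same \<open>y\<close> serves both sides: \<open>x\<close> and the image of
    \<open>y\<close> each sum to zero, so agreement off the sink forces agreement at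
    \<open>s\<close>.\<close>
  proof (rule iff_exI, rule iffI)
    fix y assume y: "\<forall>v\<in>nonsink G s. x v = (\<Sum>w\<in>verts G. laplacian G v w * y w)"
    have "x s + (\<Sum>v\<in>nonsink G s. x v) = 0"
      using sum_x by (simp only: sum_verts_sink)
    moreover have "(\<Sum>w\<in>verts G. laplacian G s w * y w)
        + (\<Sum>v\<in>nonsink G s. \<Sum>w\<in>verts G. laplacian G v w * y w) = 0"
      using sum_mat_vec_laplacian[of y]
        sum_verts_sink[of "\<lambda>v. \<Sum>w\<in>verts G. laplacian G v w * y w"] by linarith
    moreover have "(\<Sum>v\<in>nonsink G s. x v)
        = (\<Sum>v\<in>nonsink G s. \<Sum>w\<in>verts G. laplacian G v w * y w)"
      using y by (intro sum.cong) auto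
    ultimately have "x s = (\<Sum>w\<in>verts G. laplacian G s w * y w)"
      by linarith
    with y show "\<forall>v\<in>verts G. x v = (\<Sum>w\<in>verts G. laplacian G v w * y w)"
      by blast
  qed blast
  moreover have "\<dots> \<longleftrightarrow> (\<exists>k z. \<forall>v\<in>nonsink G s.
      x v = k * int (arc_mult G s v) + (\<Sum>w\<in>nonsink G s. laplacian G v w * z w))"
  proof
    assume "\<exists>y. \<forall>v\<in>nonsink G s. x v = (\<Sum>w\<in>verts G. laplacian G v w * y w)"
    then obtain y where "\<forall>v\<in>nonsink G s. x v = (\<Sum>w\<in>verts G. laplacian G v w * y w)"
      by blast
    then show "\<exists>k z. \<forall>v\<in>nonsink G s.
        x v = k * int (arc_mult G s v) + (\<Sum>w\<in>nonsink G s. laplacian G v w * z w)"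
      by (intro exI[of _ "- y s"] exI[of _ y] ballI) (simp only: split)
  next
    assume "\<exists>k z. \<forall>v\<in>nonsink G s.
        x v = k * int (arc_mult G s v) + (\<Sum>w\<in>nonsink G s. laplacian G v w * z w)"
    then obtain k z where kz: "\<forall>v\<in>nonsink G s.
        x v = k * int (arc_mult G s v) + (\<Sum>w\<in>nonsink G s. laplacian G v w * z w)"
      by blast
    \<comment> \<open>The coefficient at the sink is \<open>- k\<close> because column
      \<open>s\<close> has entry \<open>- int (arc_mult G s v)\<close> in row
      \<open>v\<close>.\<close>
    have "x v = (\<Sum>w\<in>verts G. laplacian G v w * (z(s := - k)) w)" if v: "v \<in> nonsink G s" for v
    proof -
      have "(\<Sum>w\<in>nonsink G s. laplacian G v w * (z(s := - k)) w)
          = (\<Sum>w\<in>nonsink G s. laplacian G v w * z w)"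
        by (rule sum.cong) auto
      then show ?thesis
        using kz v by (simp only: split[OF v]) simp
    qed
    then show "\<exists>y. \<forall>v\<in>nonsink G s. x v = (\<Sum>w\<in>verts G. laplacian G v w * y w)"
      by blast
  qed
  moreover have "\<dots> \<longleftrightarrow> cls (restrict x (nonsink G s)) \<in> B"
    by (subst cls_in_generate_iff) (simp_all add: carrier_int_vecs)
  ultimately show ?thesis
    by (simp only:)
qed

lemma zero_sum_quotient_iso:
  "zero_sum_vecs (verts G) Mod column_span (verts G) (laplacian G) \<cong> K Mod B"
proof -
  have restrict_hom: "(\<lambda>x. restrict x (nonsink G s)) \<in> hom (zero_sum_vecs (verts G)) Z"
    by (auto simp: hom_def zero_sum_vecs_def carrier_int_vecs mult_int_vecs intro!: restrict_ext)
  have hom: "group_hom (zero_sum_vecs (verts G)) K (\<lambda>x. cls (restrict x (nonsink G s)))"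
    unfolding group_hom_def group_hom_axioms_def
    using hom_compose[OF restrict_hom group_hom.homh[OF cls_hom]] group_zero_sum_vecs group_critical
    by (simp add: comp_def)
  show ?thesis
  proof (rule group_hom.Mod_iso[OF group_hom_comp[OF hom]])
    have surj: "(\<lambda>x. restrict x (nonsink G s)) ` carrier (zero_sum_vecs (verts G)) = carrier Z"
    proof
      show "(\<lambda>x. restrict x (nonsink G s)) ` carrier (zero_sum_vecs (verts G)) \<subseteq> carrier Z"
        by (auto simp: carrier_int_vecs)
      show "carrier Z \<subseteq> (\<lambda>x. restrict x (nonsink G s)) ` carrier (zero_sum_vecs (verts G))"
      proof
        fix x assume x: "x \<in> carrier Z"
        \<comment> \<open>The sink entry is chosen to cancel the sum of the others.\<close>
        define y where "y = x(s := - (\<Sum>v\<in>nonsink G s. x v))"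
        have "(\<Sum>v\<in>nonsink G s. y v) = (\<Sum>v\<in>nonsink G s. x v)"
          by (rule sum.cong) (auto simp: y_def)
        then have "(\<Sum>v\<in>verts G. y v) = 0"
          unfolding sum_verts_sink by (simp add: y_def)
        then have "y \<in> carrier (zero_sum_vecs (verts G))"
          using x sink by (auto simp: zero_sum_vecs_def carrier_int_vecs extensional_def y_def)
        moreover have "x = restrict y (nonsink G s)"
          using x by (auto simp: carrier_int_vecs extensional_def y_def fun_eq_iff)
        ultimately show "x \<in> (\<lambda>x. restrict x (nonsink G s)) ` carrier (zero_sum_vecs (verts G))"
          by blast
      qed
    qed
    have "(\<lambda>x. B #>\<^bsub>K\<^esub> cls (restrict x (nonsink G s))) ` carrier (zero_sum_vecs (verts G))
        = (\<lambda>C. B #>\<^bsub>K\<^esub> C) ` (\<lambda>x. cls x) ` (\<lambda>x. restrict x (nonsink G s)) ` carrier (zero_sum_vecs (verts G))"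
      by (simp only: image_image)
    then show "(\<lambda>x. B #>\<^bsub>K\<^esub> cls (restrict x (nonsink G s))) ` carrier (zero_sum_vecs (verts G))
        = carrier (K Mod B)"
      by (simp only: surj carrier_critical carrier_FactGroup)
    show "column_span (verts G) (laplacian G) \<subseteq> carrier (zero_sum_vecs (verts G))"
      by (rule column_span_laplacian_subset)
    fix x assume x: "x \<in> carrier (zero_sum_vecs (verts G))"
    have "cls (restrict x (nonsink G s)) \<in> carrier K"
      by (rule cls_closed) (simp add: carrier_int_vecs)
    from quotient_eq_one_iff[OF this]
    show "B #>\<^bsub>K\<^esub> cls (restrict x (nonsink G s)) = \<one>\<^bsub>K Mod B\<^esub>
        \<longleftrightarrow> x \<in> column_span (verts G) (laplacian G)"
      unfolding zero_sum_column_span_iff[OF x] .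
  qed
qed

text \<open>The isomorphism was built out of this quotient; reversing it requires the quotient to be
  a group.\<close>

lemma group_zero_sum_quotient:
  "group (zero_sum_vecs (verts G) Mod column_span (verts G) (laplacian G))"
proof (rule normal.factorgroup_is_group, rule comm_group.subgroup_imp_normal)
  show "comm_group (zero_sum_vecs (verts G))"
    by (rule group.group_comm_groupI[OF group_zero_sum_vecs])
      (auto simp: zero_sum_vecs_def mult_int_vecs add.commute)
  have "subgroup (column_span (verts G) (laplacian G))
      ((int_vecs (verts G))\<lparr>carrier := carrier (zero_sum_vecs (verts G))\<rparr>)"
    by (rule group.subgroup_incl[OF group_int_vecs subgroup_column_span subgroup_zero_sum_vecs
          column_span_laplacian_subset])
  then show "subgroup (column_span (verts G) (laplacian G)) (zero_sum_vecs (verts G))"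
    by (simp add: zero_sum_vecs_def)
qed

end

theorem theorem2p10:
  fixes G :: "('a, 'b) pre_digraph" and s :: 'a
  assumes "fin_digraph G" and "strongly_connected G" and "s \<in> verts G"
  shows "sandpile_group G s Mod generate (sandpile_group G s) {gamma G s}
           \<cong> critical_group G s Mod generate (critical_group G s) {beta_class G s}
       \<and> critical_group G s Mod generate (critical_group G s) {beta_class G s}
           \<cong> zero_sum_vecs (verts G) Mod column_span (verts G) (laplacian G)"
proof -
  interpret sandpile_digraph G s
    using assms by (simp add: sandpile_digraph_def sandpile_digraph_axioms_def)
  show ?thesis
    using sandpile_quotient_iso group.iso_sym[OF group_zero_sum_quotient zero_sum_quotient_iso] by blast
qed

end
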